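(* Let $a<x^*<b$ be real numbers, let $l$ be a natural number, and let $f^-,f^+\in\mathcal{C}^{l+1}([a,b])$ be real-valued functions. Define $f:[a,b]\to\mathbb{R}$ by $f(x)=f^-(x)$ for $a\le x<x^*$ and $f(x)=f^+(x)$ for $x^*\le x\le b$. Let $[f^{(k)}]$ be the jumps and $C$ the correction polynomial defined in the context. Then $$\int_a^b f(x)\,dx=\int_a^b f^-(x)\,dx+\int_{x^*}^b C(x)\,dx+E,$$ where $$\int_{x^*}^b C(x)\,dx=\sum_{k=1}^{l+1}\frac{[f^{(k-1)}]}{k!}(b-x^* )^k,$$ and the truncation error $E$ (the quantity defined by the first identity) satisfies $$E\le \frac{\|(f^+)^{(l+1)}\|_{\infty,[a,b]}+\|(f^-)^{(l+1)}\|_{\infty,[a,b]}}{(l+1)!}(b-x^* )^{l+2}.$$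
   Context: For $0\le k\le l$, the jump of the $k$-th derivative at $x^*$ is $[f^{(k)}]=\lim_{x\to x^{*+}}(f^+)^{(k)}(x)-\lim_{x\to x^{*-}}(f^-)^{(k)}(x)$, where the $0$-th derivative is the function itself. The correction polynomial is $C(x)=\sum_{i=0}^{l}\frac{[f^{(i)}]}{i!}(x-x^* )^i$ for $x\ge x^*$. The norm $\|g\|_{\infty,[a,b]}$ denotes $\sup_{x\in[a,b]}|g(x)|$. *)

theory Defs
  imports "HOL-Analysis.Analysis"
begin

text \<open>
  The \<open>k\<close>-th derivative relative to a set \<open>S\<close>: at an endpoint of \<open>S = {a..b}\<close> the derivative
  is the one-sided one, at interior points it is the usual one.
\<close>

primrec nth_deriv_on :: "real set \<Rightarrow> nat \<Rightarrow> (real \<Rightarrow> real) \<Rightarrow> real \<Rightarrow> real" where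
  "nth_deriv_on S 0 g = g"
| "nth_deriv_on S (Suc k) g = (\<lambda>x. vector_derivative (nth_deriv_on S k g) (at x within S))"

definition C_k_on :: "nat \<Rightarrow> real set \<Rightarrow> (real \<Rightarrow> real) \<Rightarrow> bool" where
  "C_k_on n S g \<longleftrightarrow>
     (\<forall>k<n. nth_deriv_on S k g differentiable_on S) \<and>
     (\<forall>k\<le>n. continuous_on S (nth_deriv_on S k g))"

definition sup_norm_on :: "real set \<Rightarrow> (real \<Rightarrow> real) \<Rightarrow> real" where
  "sup_norm_on S g = (SUP x\<in>S. \<bar>g x\<bar>)"

text \<open>
  Below, \<open>S\<close> is the common domain \<open>[a,b]\<close> of the two pieces \<open>fm\<close>, \<open>fp\<close> (the functions
  \<open>f\<^sup>-\<close>, \<open>f\<^sup>+\<close>), and \<open>xs\<close> is the break point \<open>x\<^sup>*\<close>.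
\<close>

definition piecewise :: "real \<Rightarrow> (real \<Rightarrow> real) \<Rightarrow> (real \<Rightarrow> real) \<Rightarrow> real \<Rightarrow> real" where
  "piecewise xs fm fp x = (if x < xs then fm x else fp x)"

definition jump :: "real set \<Rightarrow> real \<Rightarrow> (real \<Rightarrow> real) \<Rightarrow> (real \<Rightarrow> real) \<Rightarrow> nat \<Rightarrow> real" where
  "jump S xs fm fp k =
     Lim (at_right xs) (nth_deriv_on S k fp) - Lim (at_left xs) (nth_deriv_on S k fm)"

text \<open>Only the values of the correction polynomial for \<open>x \<ge> xs\<close> matter.\<close>

definition correction_poly ::
    "real set \<Rightarrow> real \<Rightarrow> nat \<Rightarrow> (real \<Rightarrow> real) \<Rightarrow> (real \<Rightarrow> real) \<Rightarrow> real \<Rightarrow> real" where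
  "correction_poly S xs l fm fp x =
     (\<Sum>i=0..l. jump S xs fm fp i / fact i * (x - xs) ^ i)"

text \<open>
  The truncation error of the corrected quadrature: the number \<open>E\<close> for which
  \<open>\<integral>\<^sub>a\<^sup>b f = \<integral>\<^sub>a\<^sup>b f\<^sup>- + \<integral> C + E\<close> holds, the middle integral being over \<open>[xs,b]\<close>.
\<close>

definition truncation_error ::
    "real \<Rightarrow> real \<Rightarrow> real \<Rightarrow> nat \<Rightarrow> (real \<Rightarrow> real) \<Rightarrow> (real \<Rightarrow> real) \<Rightarrow> real" where
  "truncation_error a b xs l fm fp =
     integral {a..b} (piecewise xs fm fp) - integral {a..b} fm
       - integral {xs..b} (correction_poly {a..b} xs l fm fp)"

end

theory Submission
  imports Defs
begin

text \<open>
  Left of the break point the piecewise function is \<open>fm\<close>, and right of it it exceeds \<open>fm\<close> by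
  \<open>fp - fm\<close>. So the truncation error is the integral of \<open>(fp - fm) - C\<close> over \<open>{xs..b}\<close>.
  Since the derivatives of \<open>fm\<close> and \<open>fp\<close> are continuous, the jumps are differences of
  derivatives at the break point, and the correction polynomial \<open>C\<close> is the difference of the
  Taylor polynomials of degree \<open>l\<close> of \<open>fp\<close> and \<open>fm\<close> there (\<open>correction_poly_eq_Taylor\<close>).
  Hence the integrand is a difference of two Lagrange remainders of order \<open>l + 1\<close>, each bounded by
  \<open>C_k_on_Taylor_bound\<close>. Replacing \<open>x - xs\<close> by \<open>b - xs\<close> in these bounds makes them constant,
  and the length of the interval contributes the last factor \<open>b - xs\<close>.
\<close>

lemma C_k_on_has_real_derivative:
  assumes "C_k_on n {a..b} g" "k < n" "a < t" "t < b"
  shows "(nth_deriv_on {a..b} k g has_real_derivative nth_deriv_on {a..b} (Suc k) g t) (at t)"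
proof -
  have "nth_deriv_on {a..b} k g differentiable (at t within {a..b})"
    using assms unfolding C_k_on_def differentiable_on_def by auto
  then have "(nth_deriv_on {a..b} k g has_vector_derivative nth_deriv_on {a..b} (Suc k) g t)
      (at t within {a..b})"
    by (simp add: vector_derivative_works)
  moreover have "at t within {a..b} = at t"
    using assms by (intro at_within_interior) auto
  ultimately show ?thesis
    by (simp add: has_real_derivative_iff_has_vector_derivative)
qed

lemma C_k_on_isCont:
  assumes "C_k_on n {a..b} g" "k \<le> n" "a < t" "t < b"
  shows "isCont (nth_deriv_on {a..b} k g) t"
proof -
  have "continuous_on {a..b} (nth_deriv_on {a..b} k g)"
    using assms unfolding C_k_on_def by auto
  then show ?thesis
    using assms by (intro continuous_on_interior) auto
qed

lemma jump_eq_diff: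
  assumes "C_k_on n {a..b} fm" "C_k_on n {a..b} fp" "k \<le> n" "a < xs" "xs < b"
  shows "jump {a..b} xs fm fp k = nth_deriv_on {a..b} k fp xs - nth_deriv_on {a..b} k fm xs"
proof -
  have "(nth_deriv_on {a..b} k fp \<longlongrightarrow> nth_deriv_on {a..b} k fp xs) (at_right xs)"
    using C_k_on_isCont[OF assms(2-5)] unfolding isCont_def
    by (rule tendsto_within_subset) auto
  moreover have "(nth_deriv_on {a..b} k fm \<longlongrightarrow> nth_deriv_on {a..b} k fm xs) (at_left xs)"
    using C_k_on_isCont[OF assms(1,3-5)] unfolding isCont_def
    by (rule tendsto_within_subset) auto
  ultimately show ?thesis
    unfolding jump_def by (simp add: tendsto_Lim)
qed

lemma correction_poly_eq_Taylor:
  assumes "C_k_on n {a..b} fm" "C_k_on n {a..b} fp" "l \<le> n" "a < xs" "xs < b"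
  shows "correction_poly {a..b} xs l fm fp x =
    (\<Sum>i\<le>l. nth_deriv_on {a..b} i fp xs / fact i * (x - xs) ^ i) -
    (\<Sum>i\<le>l. nth_deriv_on {a..b} i fm xs / fact i * (x - xs) ^ i)"
  unfolding correction_poly_def sum_subtractf[symmetric] atLeast0AtMost
  using assms by (intro sum.cong) (auto simp: jump_eq_diff diff_divide_distrib left_diff_distrib)

text \<open>
  Compactness and continuity make the set of values bounded, and only then is the supremum
  of a set of reals an upper bound of it.
\<close>
lemma abs_le_sup_norm_on:
  assumes "compact S" "continuous_on S g" "x \<in> S"
  shows "\<bar>g x\<bar> \<le> sup_norm_on S g"
proof -
  have "compact ((\<lambda>x. \<bar>g x\<bar>) ` S)"
    using assms by (intro compact_continuous_image continuous_intros)
  then have "bdd_above ((\<lambda>x. \<bar>g x\<bar>) ` S)"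
    by (intro bounded_imp_bdd_above compact_imp_bounded)
  then show ?thesis
    unfolding sup_norm_on_def using assms by (intro cSUP_upper)
qed

text \<open>
  This is the Lagrange form of the remainder. The point \<open>x = b\<close> is left out because
  \<open>Taylor_up\<close> asks for two-sided derivatives on the whole of \<open>{c..x}\<close>, while at \<open>b\<close> only
  one-sided ones are at hand. A single point does not affect the integral of the remainder.
\<close>
lemma C_k_on_Taylor_bound:
  assumes g: "C_k_on (Suc l) {a..b} g" and "a < c" "c \<le> x" "x < b"
  shows "\<bar>g x - (\<Sum>i\<le>l. nth_deriv_on {a..b} i g c / fact i * (x - c) ^ i)\<bar>
    \<le> sup_norm_on {a..b} (nth_deriv_on {a..b} (Suc l) g) / fact (Suc l) * (x - c) ^ Suc l"
proof (cases "c = x")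
  case True
  \<comment> \<open>The sum collapses to its term of index zero.\<close>
  have "(\<Sum>i\<le>l. nth_deriv_on {a..b} i g c / fact i * (0::real) ^ i) = g c"
    by (subst sum.atMost_shift) simp
  then show ?thesis using True by simp
next
  case False
  let ?D = "\<lambda>k. nth_deriv_on {a..b} k g"
  have "\<exists>t>c. t < x \<and> g x = (\<Sum>i<Suc l. ?D i c / fact i * (x - c) ^ i)
      + ?D (Suc l) t / fact (Suc l) * (x - c) ^ Suc l"
  proof (rule Taylor_up)
    show "\<forall>m t. m < Suc l \<and> c \<le> t \<and> t \<le> x \<longrightarrow> DERIV (?D m) t :> ?D (Suc m) t"
      using C_k_on_has_real_derivative[OF g] assms by fastforce
  qed (use False assms in auto)
  then obtain t where t: "c < t" "t < x"
    and eq: "g x = (\<Sum>i<Suc l. ?D i c / fact i * (x - c) ^ i)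
      + ?D (Suc l) t / fact (Suc l) * (x - c) ^ Suc l"
    by blast
  have "\<bar>?D (Suc l) t\<bar> \<le> sup_norm_on {a..b} (?D (Suc l))"
    using g t assms unfolding C_k_on_def by (intro abs_le_sup_norm_on) auto
  then have "\<bar>?D (Suc l) t\<bar> / fact (Suc l) * (x - c) ^ Suc l
      \<le> sup_norm_on {a..b} (?D (Suc l)) / fact (Suc l) * (x - c) ^ Suc l"
    using assms by (intro mult_right_mono divide_right_mono) auto
  moreover have "\<bar>g x - (\<Sum>i\<le>l. ?D i c / fact i * (x - c) ^ i)\<bar>
      = \<bar>?D (Suc l) t\<bar> / fact (Suc l) * (x - c) ^ Suc l"
    unfolding eq lessThan_Suc_atMost using assms
    by (simp add: abs_mult abs_divide power_abs del: nth_deriv_on.simps power_Suc fact_Suc)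
  ultimately show ?thesis by simp
qed

lemma has_integral_correction_poly:
  assumes "xs \<le> b"
  shows "(correction_poly S xs l fm fp has_integral
    (\<Sum>k=1..l + 1. jump S xs fm fp (k - 1) / fact k * (b - xs) ^ k)) {xs..b}"
proof -
  let ?F = "\<lambda>x. \<Sum>i=0..l. jump S xs fm fp i / fact (Suc i) * (x - xs) ^ Suc i"
  have "((\<lambda>x. correction_poly S xs l fm fp x) has_integral ?F b - ?F xs) {xs..b}"
  proof (rule fundamental_theorem_of_calculus[OF assms])
    fix x
    have *: "((\<lambda>x. c / fact (Suc i) * (x - xs) ^ Suc i) has_real_derivative
        c / fact i * (x - xs) ^ i) (at x within {xs..b})" for c and i :: nat
    proof -
      have "((\<lambda>x. c / fact (Suc i) * (x - xs) ^ Suc i) has_real_derivative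
        c / fact (Suc i) * (real (Suc i) * (x - xs) ^ i)) (at x within {xs..b})"
        by (auto intro!: derivative_eq_intros simp del: fact_Suc power_Suc)
      then show ?thesis by (simp add: field_simps del: of_nat_Suc)
    qed
    show "(?F has_vector_derivative correction_poly S xs l fm fp x) (at x within {xs..b})"
      unfolding correction_poly_def has_real_derivative_iff_has_vector_derivative[symmetric]
      by (intro DERIV_sum *)
  qed
  moreover have "?F b = (\<Sum>k=1..l + 1. jump S xs fm fp (k - 1) / fact k * (b - xs) ^ k)"
    using sum.shift_bounds_cl_Suc_ivl[of
      "\<lambda>k. jump S xs fm fp (k - 1) / fact k * (b - xs) ^ k" 0 l]
    by (simp del: fact_Suc power_Suc)
  ultimately show ?thesis by simp
qed

text \<open>
  On \<open>{a..xs}\<close> the piecewise function and \<open>fm\<close> differ at most at the point \<open>xs\<close>, so this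
  part of the two integrals over \<open>{a..b}\<close> cancels.
\<close>
lemma truncation_error_has_integral:
  assumes "a < xs" "xs < b" "continuous_on {a..b} fm" "continuous_on {a..b} fp"
  shows "((\<lambda>x. fp x - fm x - correction_poly {a..b} xs l fm fp x) has_integral
    truncation_error a b xs l fm fp) {xs..b}"
proof -
  let ?C = "correction_poly {a..b} xs l fm fp"
  have sub: "continuous_on {a..xs} fm" "continuous_on {xs..b} fm" "continuous_on {xs..b} fp"
    using assms by (auto intro: continuous_on_subset)
  have m1: "(fm has_integral integral {a..xs} fm) {a..xs}"
    and m2: "(fm has_integral integral {xs..b} fm) {xs..b}"
    and p: "(fp has_integral integral {xs..b} fp) {xs..b}"
    by (intro integrable_integral integrable_continuous_real sub)+
  have "(piecewise xs fm fp has_integral integral {a..xs} fm) {a..xs}"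
    by (rule has_integral_spike_finite[OF _ _ m1, of "{xs}"]) (auto simp: piecewise_def)
  moreover have "(piecewise xs fm fp has_integral integral {xs..b} fp) {xs..b}"
    by (rule has_integral_eq[OF _ p]) (auto simp: piecewise_def)
  ultimately have "(piecewise xs fm fp has_integral
      integral {a..xs} fm + integral {xs..b} fp) {a..b}"
    using assms by (intro has_integral_combine[of a xs b]) auto
  moreover have "(fm has_integral integral {a..xs} fm + integral {xs..b} fm) {a..b}"
    using assms m1 m2 by (intro has_integral_combine[of a xs b]) auto
  ultimately have "truncation_error a b xs l fm fp
      = integral {xs..b} fp - integral {xs..b} fm - integral {xs..b} ?C"
    unfolding truncation_error_def by (simp add: integral_unique)
  moreover have "(?C has_integral integral {xs..b} ?C) {xs..b}"
    using has_integral_correction_poly[of xs b] assms by (blast intro: integrable_integral less_imp_le)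
  ultimately show ?thesis
    using has_integral_diff[OF has_integral_diff[OF p m2]] by simp
qed

theorem theorem2p1:
  fixes a b xs :: real and l :: nat and fm fp f C :: "real \<Rightarrow> real" and E :: real
  assumes "a < xs" and "xs < b"
    and "C_k_on (l + 1) {a..b} fm" and "C_k_on (l + 1) {a..b} fp"
  defines "f \<equiv> piecewise xs fm fp"
    and "C \<equiv> correction_poly {a..b} xs l fm fp"
    and "E \<equiv> truncation_error a b xs l fm fp"
  shows "integral {a..b} f = integral {a..b} fm + integral {xs..b} C + E \<and>
     integral {xs..b} C = (\<Sum>k=1..l + 1. jump {a..b} xs fm fp (k - 1) / fact k * (b - xs) ^ k) \<and>
     E \<le> (sup_norm_on {a..b} (nth_deriv_on {a..b} (l + 1) fp)
           + sup_norm_on {a..b} (nth_deriv_on {a..b} (l + 1) fm)) / fact (l + 1)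
          * (b - xs) ^ (l + 2)"
proof (intro conjI)
  show "integral {a..b} f = integral {a..b} fm + integral {xs..b} C + E"
    unfolding f_def C_def E_def truncation_error_def by simp
  show "integral {xs..b} C = (\<Sum>k=1..l + 1. jump {a..b} xs fm fp (k - 1) / fact k * (b - xs) ^ k)"
    unfolding C_def using assms(2) by (intro integral_unique has_integral_correction_poly) simp
next
  have reg: "C_k_on (Suc l) {a..b} fm" "C_k_on (Suc l) {a..b} fp"
    using assms(3,4) by simp_all
  have cont: "continuous_on {a..b} (nth_deriv_on {a..b} k fm)"
    "continuous_on {a..b} (nth_deriv_on {a..b} k fp)" if "k \<le> Suc l" for k
    using reg that unfolding C_k_on_def by auto
  define N where "N = (\<lambda>g. sup_norm_on {a..b} (nth_deriv_on {a..b} (Suc l) g))"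
  define B where "B = (N fp + N fm) / fact (Suc l) * (b - xs) ^ Suc l"
  have "0 \<le> N fm" "0 \<le> N fp"
    unfolding N_def using assms(1,2) cont[of "Suc l"]
    by (auto intro!: order_trans[OF abs_ge_zero abs_le_sup_norm_on[of _ _ xs]])
  then have N: "0 \<le> N fp + N fm" by simp
  have bound: "norm (fp x - fm x - C x) \<le> B" if x: "x \<in> {xs..b} - {b}" for x
  proof -
    let ?T = "\<lambda>g. \<Sum>i\<le>l. nth_deriv_on {a..b} i g xs / fact i * (x - xs) ^ i"
    have x': "xs \<le> x" "x < b"
      using x by auto
    have C: "C x = ?T fp - ?T fm"
      unfolding C_def using assms(1,2) by (intro correction_poly_eq_Taylor[OF reg]) auto
    have rp: "\<bar>fp x - ?T fp\<bar> \<le> N fp / fact (Suc l) * (x - xs) ^ Suc l"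
      and rm: "\<bar>fm x - ?T fm\<bar> \<le> N fm / fact (Suc l) * (x - xs) ^ Suc l"
      unfolding N_def
      by (fact C_k_on_Taylor_bound[OF reg(2) assms(1) x']
          C_k_on_Taylor_bound[OF reg(1) assms(1) x'])+
    have "norm (fp x - fm x - C x) \<le> \<bar>fp x - ?T fp\<bar> + \<bar>fm x - ?T fm\<bar>"
      unfolding C by simp
    also have "\<dots> \<le> (N fp + N fm) / fact (Suc l) * (x - xs) ^ Suc l"
      using add_mono[OF rp rm] by (simp add: add_divide_distrib distrib_right del: fact_Suc power_Suc)
    also have "\<dots> \<le> B"
      unfolding B_def using x N by (intro mult_left_mono power_mono) auto
    finally show ?thesis .
  qed
  have "((\<lambda>x. fp x - fm x - C x) has_integral E) (cbox xs b)"
    unfolding C_def E_def cbox_interval using assms(1,2) cont[of 0]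
    by (intro truncation_error_has_integral) auto
  moreover have "0 \<le> B"
    unfolding B_def using N assms(2) by simp
  ultimately have "norm E \<le> B * measure lborel (cbox xs b)"
    using bound by (intro has_integral_bound_spike_finite[of B "{b}"]) auto
  then have "E \<le> B * (b - xs)"
    using assms(2) by simp
  also have "B * (b - xs) = (N fp + N fm) / fact (l + 1) * (b - xs) ^ (l + 2)"
    unfolding B_def by (simp add: mult_ac)
  finally show "E \<le> (sup_norm_on {a..b} (nth_deriv_on {a..b} (l + 1) fp)
           + sup_norm_on {a..b} (nth_deriv_on {a..b} (l + 1) fm)) / fact (l + 1)
          * (b - xs) ^ (l + 2)"
    unfolding N_def by simp
qed

end
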